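(* Let $H$ be a bi-adjacency matrix representing a protograph $\mathcal G=(\mathcal V\cup\mathcal C,\mathcal E)$. Let $\mathcal J\subseteq\{1,\dots,|\mathcal V|\}$ and $\mathcal I\subseteq\{1,\dots,|\mathcal C|\}$ be sets of column and row indices, respectively, let $H_{\mathcal J}$ be the sub-matrix consisting of the columns of $H$ indexed by $\mathcal J$, and let $H^{(\mathcal I)}$ be the sub-matrix consisting of the rows of $H$ indexed by $\mathcal I$. Then $$\epsilon^*\bigl(H^{(\mathcal I)}\bigr)\le\epsilon^*(H)\le\epsilon^*\bigl(H_{\mathcal J}\bigr).$$
   Context: A protograph is a finite bipartite (multi)graph with variable nodes (VNs) $\mathcal V$ and check nodes (CNs) $\mathcal C$, represented by a bi-adjacency matrix with nonnegative integer entries: columns are VNs, rows are CNs, and each entry is the number of edges between the corresponding CN and VN. Density evolution on the BEC$(\epsilon)$: each edge $e$ carries $x_\ell(e)$ (VN-to-CN) and $u_\ell(e)$ (CN-to-VN) with $x_{-1}=u_{-1}=1$ and, for $\ell\ge0$, for an edge $e$ joining VN $v$ and CN $c$, $$u_\ell(e)=1-\prod_{e'\ni c,\,e'\ne e}(1-x_{\ell-1}(e')),\qquad x_\ell(e)=\epsilon\prod_{e'\ni v,\,e'\neq e}u_\ell(e'),$$ (empty products equal $1$), and $P_\ell(v,\epsilon)=\epsilon\prod_{e\ni v}u_\ell(e)$. The BP threshold of the protograph represented by $H$ is $$\epsilon^*(H)=\sup\{\epsilon\in[0,1]:\ \lim_{\ell\to\infty}P_\ell(v,\epsilon)=0\ \text{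 for every VN } v\}.$$ *)

theory Defs
  imports Complex_Main "Jordan_Normal_Form.DL_Submatrix"
begin

text \<open>
  A protograph is given by its bi-adjacency matrix \<open>H :: nat mat\<close>: rows are check nodes, columns are
  variable nodes, and both are indexed from 0.  The triple \<open>(c, v, k)\<close> is the \<open>k\<close>-th of the
  \<open>H $$ (c, v)\<close> parallel edges joining check node \<open>c\<close> and variable node \<open>v\<close>.
\<close>

type_synonym edge = "nat \<times> nat \<times> nat"

definition edges :: "nat mat \<Rightarrow> edge set" where
  "edges H = {(c, v, k). c < dim_row H \<and> v < dim_col H \<and> k < H $$ (c, v)}"

definition cn_edges :: "nat mat \<Rightarrow> nat \<Rightarrow> edge set" where
  "cn_edges H c = {e \<in> edges H. fst e = c}"

definition vn_edges :: "nat mat \<Rightarrow> nat \<Rightarrow> edge set" where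
  "vn_edges H v = {e \<in> edges H. fst (snd e) = v}"

text \<open>
  Density evolution starts at iteration \<open>-1\<close>, so the iteration index is shifted by one:
  \<open>vn_msg H \<epsilon> n\<close> is $x_{n-1}$ and \<open>cn_msg H \<epsilon> n\<close> is $u_{n-1}$.
\<close>

fun vn_msg :: "nat mat \<Rightarrow> real \<Rightarrow> nat \<Rightarrow> edge \<Rightarrow> real"
  and cn_msg :: "nat mat \<Rightarrow> real \<Rightarrow> nat \<Rightarrow> edge \<Rightarrow> real" where
  "vn_msg H \<epsilon> 0 (c, v, k) = 1"
| "cn_msg H \<epsilon> 0 (c, v, k) = 1"
| "cn_msg H \<epsilon> (Suc n) (c, v, k) =
     1 - (\<Prod>e' \<in> cn_edges H c - {(c, v, k)}. 1 - vn_msg H \<epsilon> n e')"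
| "vn_msg H \<epsilon> (Suc n) (c, v, k) =
     \<epsilon> * (\<Prod>e' \<in> vn_edges H v - {(c, v, k)}. cn_msg H \<epsilon> (Suc n) e')"

text \<open>The index of \<open>erasure_prob\<close> is not shifted: \<open>erasure_prob H \<epsilon> l v\<close> is $P_l(v, \epsilon)$.\<close>

definition erasure_prob :: "nat mat \<Rightarrow> real \<Rightarrow> nat \<Rightarrow> nat \<Rightarrow> real" where
  "erasure_prob H \<epsilon> l v = \<epsilon> * (\<Prod>e \<in> vn_edges H v. cn_msg H \<epsilon> (Suc l) e)"

definition bp_threshold :: "nat mat \<Rightarrow> real" where
  "bp_threshold H =
     Sup {\<epsilon> \<in> {0..1}. \<forall>v < dim_col H. (\<lambda>l. erasure_prob H \<epsilon> l v) \<longlonglongrightarrow> 0}"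

end

theory Submission
  imports Defs
begin

text \<open>
  All messages are probabilities, and each is monotone in the incoming ones.  Removing columns
  deletes factors \<open>1 - x \<le> 1\<close> at the check nodes, which lowers the messages on the surviving edges;
  removing rows deletes factors \<open>u \<le> 1\<close> at the variable nodes, which raises them.  By induction on
  the number of iterations the erasure probabilities are comparable, and hence so are the sets of
  channel parameters whose suprema are the thresholds.
\<close>

section \<open>Comparison of products along an embedding of index sets\<close>

lemma prod_le_prod_inj_on:
  fixes f :: "'b \<Rightarrow> real"
  assumes "finite B" "inj_on h A" "h ` A \<subseteq> B"
    and "\<And>y. y \<in> B \<Longrightarrow> f y \<in> {0..1}"
    and "\<And>x. x \<in> A \<Longrightarrow> f (h x) \<le> g x"
  shows "prod f B \<le> prod g A"
proof -
  have "prod f B = prod f (B - h ` A) * prod f (h ` A)"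
    using assms by (simp add: prod.subset_diff)
  also have "\<dots> \<le> 1 * prod f (h ` A)"
    using assms by (intro mult_right_mono prod_le_1 prod_nonneg) auto
  also have "\<dots> = (\<Prod>x\<in>A. f (h x))"
    using assms by (simp add: prod.reindex)
  also have "\<dots> \<le> prod g A"
    using assms by (intro prod_mono) auto
  finally show ?thesis .
qed

text \<open>For nodes that keep all their edges: \<open>h\<close> merely renames the
  factors.\<close>

lemma prod_le_prod_bij:
  fixes f :: "'a \<Rightarrow> real"
  assumes "inj_on h A" "h ` A = B"
    and "\<And>x. x \<in> A \<Longrightarrow> 0 \<le> f x \<and> f x \<le> g (h x)"
  shows "prod f A \<le> prod g B"
proof -
  have "prod g B = (\<Prod>x\<in>A. g (h x))"
    using assms(1,2) by (auto simp: prod.reindex)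
  with assms(3) show ?thesis
    by (simp add: prod_mono)
qed

section \<open>Submatrix indices versus retained indices\<close>

text \<open>The cardinality is a dimension of the submatrix. Since \<open>pick I\<close> enumerates
  \<open>I\<close> in increasing order, a retained \<open>i\<close> sits at the position given by
  the number of smaller elements of \<open>I\<close>.\<close>

lemma pick_image: "pick I ` {..<card {i. i < n \<and> i \<in> I}} = {i. i < n \<and> i \<in> I}"
proof (intro equalityI subsetI)
  fix i assume "i \<in> pick I ` {..<card {i. i < n \<and> i \<in> I}}"
  then obtain m where m: "m < card {i. i < n \<and> i \<in> I}" "i = pick I m"
    by auto
  with pick_reduce_set[OF m(1)] pick_in_set_le[OF m(1)]
  show "i \<in> {i. i < n \<and> i \<in> I}" by simp
next
  fix i assume i: "i \<in> {i. i < n \<and> i \<in> I}"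
  then have "{a \<in> I. a < i} \<subset> {i. i < n \<and> i \<in> I}"
    by auto
  then have "card {a \<in> I. a < i} < card {i. i < n \<and> i \<in> I}"
    by (intro psubset_card_mono) auto
  moreover have "i = pick I (card {a \<in> I. a < i})"
    using i by (simp add: pick_card_in_set)
  ultimately show "i \<in> pick I ` {..<card {i. i < n \<and> i \<in> I}}"
    by blast
qed

lemma inj_on_pick: "inj_on (pick I) {..<card {i. i < n \<and> i \<in> I}}"
  \<comment> \<open>By \<open>pick_image\<close>, a finite set is mapped onto one of the same
    cardinality.\<close>
  by (rule eq_card_imp_inj_on) (simp_all add: pick_image)

section \<open>Messages are probabilities\<close>

lemma finite_edges: "finite (edges H)"
proof (rule finite_subset)
  show "edges H \<subseteq> (\<Union>c<dim_row H. \<Union>v<dim_col H. \<Union>k<H $$ (c, v). {(c, v, k)})"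
    by (auto simp: edges_def)
qed auto

lemma msg_bounds:
  assumes "\<epsilon> \<in> {0..1}"
  shows "vn_msg H \<epsilon> n e \<in> {0..1}" "cn_msg H \<epsilon> n e \<in> {0..1}"
proof -
  have "(\<forall>e. vn_msg H \<epsilon> n e \<in> {0..1}) \<and> (\<forall>e. cn_msg H \<epsilon> n e \<in> {0..1})"
  proof (induction n)
    case 0
    show ?case by auto
  next
    case (Suc n)
    \<comment> \<open>Check nodes come first: \<open>vn_msg\<close> at \<open>Suc n\<close> is
      computed from \<open>cn_msg\<close> at the same index.\<close>
    have u: "cn_msg H \<epsilon> (Suc n) e \<in> {0..1}" for e
      using Suc by (cases e) (auto intro!: prod_nonneg prod_le_1)
    have "vn_msg H \<epsilon> (Suc n) e \<in> {0..1}" for e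
    proof -
      obtain c v k where e: "e = (c, v, k)" by (cases e)
      let ?p = "\<Prod>e' \<in> vn_edges H v - {e}. cn_msg H \<epsilon> (Suc n) e'"
      have "0 \<le> ?p" "?p \<le> 1"
        using u by (auto intro!: prod_nonneg prod_le_1 simp del: cn_msg.simps)
      with assms show ?thesis
        by (auto simp: e mult_le_one simp del: cn_msg.simps)
    qed
    with u show ?case by blast
  qed
  then show "vn_msg H \<epsilon> n e \<in> {0..1}" "cn_msg H \<epsilon> n e \<in> {0..1}"
    by blast+
qed

lemma erasure_prob_nonneg: "\<epsilon> \<in> {0..1} \<Longrightarrow> 0 \<le> erasure_prob H \<epsilon> l v"
  unfolding erasure_prob_def using msg_bounds(2)[of \<epsilon>]
  by (auto intro!: mult_nonneg_nonneg prod_nonneg simp del: cn_msg.simps)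

section \<open>The edges of a submatrix inside the original protograph\<close>

text \<open>A submatrix renumbers its rows and columns from 0, so its edges are not literally edges
  of \<open>H\<close>; this map undoes the renumbering. Entries are copied, so the number
  \<open>k\<close> of a parallel edge stays.\<close>

definition edge_emb :: "nat set \<Rightarrow> nat set \<Rightarrow> edge \<Rightarrow> edge" where
  "edge_emb I J = (\<lambda>(c, v, k). (pick I c, pick J v, k))"

context
  fixes H :: "nat mat" and I J :: "nat set"
begin

private abbreviation (input) "S \<equiv> submatrix H I J"

lemma pick_lt:
  "c < dim_row S \<Longrightarrow> pick I c < dim_row H \<and> pick I c \<in> I"
  "v < dim_col S \<Longrightarrow> pick J v < dim_col H \<and> pick J v \<in> J"
  using pick_image[of I "dim_row H"] pick_image[of J "dim_col H"]
  by (auto simp: dim_submatrix)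

lemma pick_eq_iff:
  "c < dim_row S \<Longrightarrow> c' < dim_row S \<Longrightarrow> pick I c = pick I c' \<longleftrightarrow> c = c'"
  "v < dim_col S \<Longrightarrow> v' < dim_col S \<Longrightarrow> pick J v = pick J v' \<longleftrightarrow> v = v'"
  using inj_on_pick[of I "dim_row H"] inj_on_pick[of J "dim_col H"]
  by (auto simp: dim_submatrix inj_on_def)

lemma submatrix_entry:
  "c < dim_row S \<Longrightarrow> v < dim_col S \<Longrightarrow> S $$ (c, v) = H $$ (pick I c, pick J v)"
  by (simp add: submatrix_index dim_submatrix)

lemma inj_on_edge_emb: "inj_on (edge_emb I J) (edges S)"
  by (auto simp: inj_on_def edge_emb_def edges_def pick_eq_iff)

lemma edge_emb_image:
  "edge_emb I J ` edges S = {e \<in> edges H. fst e \<in> I \<and> fst (snd e) \<in> J}"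
proof (intro equalityI subsetI)
  fix e assume "e \<in> edge_emb I J ` edges S"
  then show "e \<in> {e \<in> edges H. fst e \<in> I \<and> fst (snd e) \<in> J}"
    using pick_lt by (auto simp: edge_emb_def edges_def submatrix_entry)
next
  fix e assume "e \<in> {e \<in> edges H. fst e \<in> I \<and> fst (snd e) \<in> J}"
  then obtain c v k where e: "e = (c, v, k)" "c \<in> I" "v \<in> J" "c < dim_row H" "v < dim_col H"
    "k < H $$ (c, v)"
    by (auto simp: edges_def)
  have "c \<in> pick I ` {..<dim_row S}" "v \<in> pick J ` {..<dim_col S}"
    using e by (simp_all add: dim_submatrix pick_image)
  then obtain c' v' where "c' < dim_row S" "c = pick I c'" "v' < dim_col S" "v = pick J v'"
    by blast
  with e have "(c', v', k) \<in> edges S" "e = edge_emb I J (c', v', k)"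
    by (auto simp: edges_def edge_emb_def submatrix_entry)
  then show "e \<in> edge_emb I J ` edges S" by blast
qed

text \<open>Injectivity of \<open>pick I\<close> keeps distinct check nodes apart. For
  \<open>J = UNIV\<close> the condition on the right is vacuous, so a check node loses no edges when
  only rows are removed. The next lemma is the dual for variable nodes.\<close>

lemma edge_emb_cn_image:
  assumes "c < dim_row S"
  shows "edge_emb I J ` cn_edges S c = {e \<in> cn_edges H (pick I c). fst (snd e) \<in> J}"
proof -
  have "edge_emb I J ` cn_edges S c = {e \<in> edge_emb I J ` edges S. fst e = pick I c}"
    using assms by (force simp: cn_edges_def edges_def edge_emb_def pick_eq_iff)
  then show ?thesis
    using pick_lt(1)[OF assms] by (auto simp: edge_emb_image cn_edges_def)
qed

lemma edge_emb_vn_image: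
  assumes "v < dim_col S"
  shows "edge_emb I J ` vn_edges S v = {e \<in> vn_edges H (pick J v). fst e \<in> I}"
proof -
  have "edge_emb I J ` vn_edges S v = {e \<in> edge_emb I J ` edges S. fst (snd e) = pick J v}"
    using assms by (force simp: vn_edges_def edges_def edge_emb_def pick_eq_iff)
  then show ?thesis
    using pick_lt(2)[OF assms] by (auto simp: edge_emb_image vn_edges_def)
qed

lemma inj_on_edge_emb_nodes:
  "inj_on (edge_emb I J) (cn_edges S c - E)" "inj_on (edge_emb I J) (vn_edges S v - E)"
  by (auto simp: cn_edges_def vn_edges_def intro!: inj_on_subset[OF inj_on_edge_emb])

text \<open>The message on an edge leaves that edge out of its product; by injectivity of the
  embedding, removing the edge commutes with taking the image.\<close>

lemma edge_emb_cn_image_diff: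
  assumes "(c, v, k) \<in> edges S"
  shows "edge_emb I J ` (cn_edges S c - {(c, v, k)}) =
         {e \<in> cn_edges H (pick I c) - {(pick I c, pick J v, k)}. fst (snd e) \<in> J}"
proof -
  have "edge_emb I J ` (cn_edges S c - {(c, v, k)}) =
        edge_emb I J ` cn_edges S c - edge_emb I J ` {(c, v, k)}"
    using assms by (intro inj_on_image_set_diff[OF inj_on_edge_emb]) (auto simp: cn_edges_def)
  with assms show ?thesis
    by (subst (asm) edge_emb_cn_image) (auto simp: edges_def edge_emb_def)
qed

lemma edge_emb_vn_image_diff:
  assumes "(c, v, k) \<in> edges S"
  shows "edge_emb I J ` (vn_edges S v - {(c, v, k)}) =
         {e \<in> vn_edges H (pick J v) - {(pick I c, pick J v, k)}. fst e \<in> I}"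
proof -
  have "edge_emb I J ` (vn_edges S v - {(c, v, k)}) =
        edge_emb I J ` vn_edges S v - edge_emb I J ` {(c, v, k)}"
    using assms by (intro inj_on_image_set_diff[OF inj_on_edge_emb]) (auto simp: vn_edges_def)
  with assms show ?thesis
    by (subst (asm) edge_emb_vn_image) (auto simp: edges_def edge_emb_def)
qed

end

section \<open>Comparison of messages under row and column removal\<close>

text \<open>Surviving check nodes keep their edges and pass larger inputs on as larger outputs;
  variable nodes lose factors that are at most 1, which raises the messages further.\<close>

lemma row_submatrix_msg_ge:
  fixes H :: "nat mat" and I :: "nat set"
  defines "S \<equiv> submatrix H I UNIV" and "h \<equiv> edge_emb I UNIV"
  assumes eps: "\<epsilon> \<in> {0..1}" and "e \<in> edges S"
  shows "vn_msg H \<epsilon> n (h e) \<le> vn_msg S \<epsilon> n e \<and> cn_msg H \<epsilon> n (h e) \<le> cn_msg S \<epsilon> n e"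
  using \<open>e \<in> edges S\<close>
proof (induction n arbitrary: e)
  case 0
  show ?case by (cases e) (auto simp: h_def edge_emb_def)
next
  case (Suc n)
  \<comment> \<open>Needed for every edge, since the update at a variable node uses the messages on
    the other edges there.\<close>
  have u: "cn_msg H \<epsilon> (Suc n) (h e) \<le> cn_msg S \<epsilon> (Suc n) e" if "e \<in> edges S" for e
  proof -
    obtain c v k where e: "e = (c, v, k)" by (cases e)
    \<comment> \<open>Passing to \<open>1 - x\<close> reverses the induction hypothesis; the outer
      \<open>1 -\<close> of the update reverses it back.\<close>
    have "(\<Prod>e' \<in> cn_edges S c - {e}. 1 - vn_msg S \<epsilon> n e')
          \<le> (\<Prod>e' \<in> cn_edges H (pick I c) - {h e}. 1 - vn_msg H \<epsilon> n e')"
    proof (rule prod_le_prod_bij[where h = h])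
      show "inj_on h (cn_edges S c - {e})"
        unfolding h_def S_def by (rule inj_on_edge_emb_nodes)
      show "h ` (cn_edges S c - {e}) = cn_edges H (pick I c) - {h e}"
        using that edge_emb_cn_image_diff[of c v k H I UNIV]
        by (auto simp: e h_def S_def edge_emb_def)
      fix x assume "x \<in> cn_edges S c - {e}"
      then show "0 \<le> 1 - vn_msg S \<epsilon> n x \<and> 1 - vn_msg S \<epsilon> n x \<le> 1 - vn_msg H \<epsilon> n (h x)"
        using Suc.IH[of x] msg_bounds(1)[OF eps, of S n x] by (auto simp: cn_edges_def)
    qed
    then show ?thesis
      by (simp add: e h_def edge_emb_def)
  qed
  obtain c v k where e: "e = (c, v, k)" by (cases e)
  \<comment> \<open>Edges to removed rows are missing on the right, so \<open>h\<close> is only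
    injective here. The column \<open>pick UNIV v\<close> is \<open>v\<close> itself, in the form
    produced by \<open>edge_emb\<close>.\<close>
  have "(\<Prod>e' \<in> vn_edges H (pick UNIV v) - {h e}. cn_msg H \<epsilon> (Suc n) e')
        \<le> (\<Prod>e' \<in> vn_edges S v - {e}. cn_msg S \<epsilon> (Suc n) e')"
  proof (rule prod_le_prod_inj_on[where h = h])
    show "inj_on h (vn_edges S v - {e})"
      unfolding h_def S_def by (rule inj_on_edge_emb_nodes)
    show "h ` (vn_edges S v - {e}) \<subseteq> vn_edges H (pick UNIV v) - {h e}"
      using Suc.prems edge_emb_vn_image_diff[of c v k H I UNIV]
      by (auto simp: e h_def S_def edge_emb_def)
  qed (use u msg_bounds(2)[OF eps] in \<open>auto simp: vn_edges_def finite_edges simp del: cn_msg.simps\<close>)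
  with eps have "vn_msg H \<epsilon> (Suc n) (h e) \<le> vn_msg S \<epsilon> (Suc n) e"
    by (auto simp: e h_def edge_emb_def simp del: cn_msg.simps intro!: mult_left_mono)
  with u[OF Suc.prems] show ?case by blast
qed

text \<open>The two node types swap roles: check nodes lose factors \<open>1 - x\<close>, which
  lowers their messages, and surviving variable nodes keep all their edges.\<close>

lemma col_submatrix_msg_le:
  fixes H :: "nat mat" and J :: "nat set"
  defines "S \<equiv> submatrix H UNIV J" and "h \<equiv> edge_emb UNIV J"
  assumes eps: "\<epsilon> \<in> {0..1}" and "e \<in> edges S"
  shows "vn_msg S \<epsilon> n e \<le> vn_msg H \<epsilon> n (h e) \<and> cn_msg S \<epsilon> n e \<le> cn_msg H \<epsilon> n (h e)"
  using \<open>e \<in> edges S\<close>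
proof (induction n arbitrary: e)
  case 0
  show ?case by (cases e) (auto simp: h_def edge_emb_def)
next
  case (Suc n)
  have u: "cn_msg S \<epsilon> (Suc n) e \<le> cn_msg H \<epsilon> (Suc n) (h e)" if "e \<in> edges S" for e
  proof -
    obtain c v k where e: "e = (c, v, k)" by (cases e)
    have "(\<Prod>e' \<in> cn_edges H (pick UNIV c) - {h e}. 1 - vn_msg H \<epsilon> n e')
          \<le> (\<Prod>e' \<in> cn_edges S c - {e}. 1 - vn_msg S \<epsilon> n e')"
    proof (rule prod_le_prod_inj_on[where h = h])
      show "inj_on h (cn_edges S c - {e})"
        unfolding h_def S_def by (rule inj_on_edge_emb_nodes)
      show "h ` (cn_edges S c - {e}) \<subseteq> cn_edges H (pick UNIV c) - {h e}"
        using that edge_emb_cn_image_diff[of c v k H UNIV J]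
        by (auto simp: e h_def S_def edge_emb_def)
    qed (use Suc.IH msg_bounds(1)[OF eps] in \<open>auto simp: cn_edges_def finite_edges\<close>)
    then show ?thesis
      by (simp add: e h_def edge_emb_def)
  qed
  obtain c v k where e: "e = (c, v, k)" by (cases e)
  have "(\<Prod>e' \<in> vn_edges S v - {e}. cn_msg S \<epsilon> (Suc n) e')
        \<le> (\<Prod>e' \<in> vn_edges H (pick J v) - {h e}. cn_msg H \<epsilon> (Suc n) e')"
  proof (rule prod_le_prod_bij[where h = h])
    show "inj_on h (vn_edges S v - {e})"
      unfolding h_def S_def by (rule inj_on_edge_emb_nodes)
    show "h ` (vn_edges S v - {e}) = vn_edges H (pick J v) - {h e}"
      using Suc.prems edge_emb_vn_image_diff[of c v k H UNIV J]
      by (auto simp: e h_def S_def edge_emb_def)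
    fix x assume "x \<in> vn_edges S v - {e}"
    then show "0 \<le> cn_msg S \<epsilon> (Suc n) x \<and> cn_msg S \<epsilon> (Suc n) x \<le> cn_msg H \<epsilon> (Suc n) (h x)"
      using u[of x] msg_bounds(2)[OF eps, of S "Suc n" x]
      by (auto simp: vn_edges_def simp del: cn_msg.simps)
  qed
  with eps have "vn_msg S \<epsilon> (Suc n) e \<le> vn_msg H \<epsilon> (Suc n) (h e)"
    by (auto simp: e h_def edge_emb_def simp del: cn_msg.simps intro!: mult_left_mono)
  with u[OF Suc.prems] show ?case by blast
qed

section \<open>Comparison of erasure probabilities\<close>

text \<open>An erasure probability is a variable node update with no edge left out, so the argument
  for the messages applies once more.\<close>

lemma erasure_prob_row_submatrix_ge:
  assumes eps: "\<epsilon> \<in> {0..1}" and v: "v < dim_col H"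
  shows "erasure_prob H \<epsilon> l v \<le> erasure_prob (submatrix H I UNIV) \<epsilon> l v"
proof -
  let ?S = "submatrix H I UNIV" and ?h = "edge_emb I UNIV"
  have "(\<Prod>e \<in> vn_edges H v. cn_msg H \<epsilon> (Suc l) e)
        \<le> (\<Prod>e \<in> vn_edges ?S v. cn_msg ?S \<epsilon> (Suc l) e)"
  proof (rule prod_le_prod_inj_on[where h = ?h])
    show "inj_on ?h (vn_edges ?S v)"
      using inj_on_edge_emb_nodes(2)[where E = "{}"] by simp
    show "?h ` vn_edges ?S v \<subseteq> vn_edges H v"
      using v edge_emb_vn_image[of v H I UNIV] by (auto simp: dim_submatrix pick_UNIV)
  qed (use row_submatrix_msg_ge[OF eps] msg_bounds(2)[OF eps] in
      \<open>auto simp: vn_edges_def finite_edges simp del: cn_msg.simps\<close>)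
  with eps show ?thesis
    by (auto simp: erasure_prob_def simp del: cn_msg.simps intro!: mult_left_mono)
qed

lemma erasure_prob_col_submatrix_le:
  assumes eps: "\<epsilon> \<in> {0..1}" and v: "v < dim_col (submatrix H UNIV J)"
  shows "erasure_prob (submatrix H UNIV J) \<epsilon> l v \<le> erasure_prob H \<epsilon> l (pick J v)"
proof -
  let ?S = "submatrix H UNIV J" and ?h = "edge_emb UNIV J"
  have "(\<Prod>e \<in> vn_edges ?S v. cn_msg ?S \<epsilon> (Suc l) e)
        \<le> (\<Prod>e \<in> vn_edges H (pick J v). cn_msg H \<epsilon> (Suc l) e)"
  proof (rule prod_le_prod_bij[where h = ?h])
    show "inj_on ?h (vn_edges ?S v)"
      using inj_on_edge_emb_nodes(2)[where E = "{}"] by simp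
    show "?h ` vn_edges ?S v = vn_edges H (pick J v)"
      using edge_emb_vn_image[OF v] by simp
    fix x assume "x \<in> vn_edges ?S v"
    then show "0 \<le> cn_msg ?S \<epsilon> (Suc l) x \<and> cn_msg ?S \<epsilon> (Suc l) x \<le> cn_msg H \<epsilon> (Suc l) (?h x)"
      using col_submatrix_msg_le[OF eps, of x H J "Suc l"] msg_bounds(2)[OF eps, of ?S "Suc l" x]
      by (auto simp: vn_edges_def simp del: cn_msg.simps)
  qed
  with eps show ?thesis
    by (auto simp: erasure_prob_def simp del: cn_msg.simps intro!: mult_left_mono)
qed

section \<open>Comparison of thresholds\<close>

text \<open>If every variable node of \<open>G\<close> is dominated by one of \<open>H\<close>, each
  parameter admissible for \<open>H\<close> is admissible for \<open>G\<close>. The dominating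
  \<open>w\<close> must serve all iterations \<open>l\<close>, so that its limit can be
  used.\<close>

lemma bp_threshold_mono:
  assumes "\<And>\<epsilon> v. \<epsilon> \<in> {0..1} \<Longrightarrow> v < dim_col G \<Longrightarrow>
    \<exists>w < dim_col H. \<forall>l. erasure_prob G \<epsilon> l v \<le> erasure_prob H \<epsilon> l w"
  shows "bp_threshold H \<le> bp_threshold G"
  unfolding bp_threshold_def
proof (rule cSup_subset_mono)
  \<comment> \<open>At \<open>\<epsilon> = 0\<close> every erasure probability is 0.\<close>
  show "{\<epsilon> \<in> {0..1}. \<forall>v < dim_col H. (\<lambda>l. erasure_prob H \<epsilon> l v) \<longlonglongrightarrow> 0} \<noteq> {}"
    by (auto simp: erasure_prob_def intro!: exI[of _ 0])
  show "bdd_above {\<epsilon> \<in> {0..1}. \<forall>v < dim_col G. (\<lambda>l. erasure_prob G \<epsilon> l v) \<longlonglongrightarrow> 0}"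
    by (rule bdd_aboveI[of _ 1]) auto
  show "{\<epsilon> \<in> {0..1}. \<forall>v < dim_col H. (\<lambda>l. erasure_prob H \<epsilon> l v) \<longlonglongrightarrow> 0}
        \<subseteq> {\<epsilon> \<in> {0..1}. \<forall>v < dim_col G. (\<lambda>l. erasure_prob G \<epsilon> l v) \<longlonglongrightarrow> 0}"
  proof clarify
    fix \<epsilon> :: real and v
    assume eps: "\<epsilon> \<in> {0..1}" and "v < dim_col G"
      and lim: "\<forall>v < dim_col H. (\<lambda>l. erasure_prob H \<epsilon> l v) \<longlonglongrightarrow> 0"
    then obtain w where "w < dim_col H" and le: "\<And>l. erasure_prob G \<epsilon> l v \<le> erasure_prob H \<epsilon> l w"
      using assms by blast
    with lim have "(\<lambda>l. erasure_prob H \<epsilon> l w) \<longlonglongrightarrow> 0"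
      by blast
    \<comment> \<open>Squeezed between 0 and the sequence at \<open>w\<close>.\<close>
    then show "(\<lambda>l. erasure_prob G \<epsilon> l v) \<longlonglongrightarrow> 0"
      by (rule tendsto_sandwich[OF _ _ tendsto_const, rotated 2])
        (simp_all add: le erasure_prob_nonneg[OF eps])
  qed
qed

theorem lemma1:
  fixes H :: "nat mat" and I J :: "nat set"
  assumes "J \<subseteq> {..<dim_col H}"
    and "I \<subseteq> {..<dim_row H}"
  shows "bp_threshold (submatrix H I UNIV) \<le> bp_threshold H \<and>
         bp_threshold H \<le> bp_threshold (submatrix H UNIV J)"
proof
  show "bp_threshold (submatrix H I UNIV) \<le> bp_threshold H"
  proof (rule bp_threshold_mono)
    fix \<epsilon> :: real and v
    assume "\<epsilon> \<in> {0..1}" "v < dim_col H"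
    \<comment> \<open>All columns are retained with their numbers, so \<open>v\<close> dominates
      itself.\<close>
    then show "\<exists>w < dim_col (submatrix H I UNIV).
        \<forall>l. erasure_prob H \<epsilon> l v \<le> erasure_prob (submatrix H I UNIV) \<epsilon> l w"
      using erasure_prob_row_submatrix_ge by (intro exI[of _ v]) (simp add: dim_submatrix)
  qed
  show "bp_threshold H \<le> bp_threshold (submatrix H UNIV J)"
  proof (rule bp_threshold_mono)
    fix \<epsilon> :: real and v
    assume "\<epsilon> \<in> {0..1}" "v < dim_col (submatrix H UNIV J)"
    \<comment> \<open>The dominating node is the column of \<open>H\<close> from which column
      \<open>v\<close> was taken.\<close>
    then show "\<exists>w < dim_col H.
        \<forall>l. erasure_prob (submatrix H UNIV J) \<epsilon> l v \<le> erasure_prob H \<epsilon> l w"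
      using erasure_prob_col_submatrix_le pick_lt(2) by (intro exI[of _ "pick J v"]) blast
  qed
qed

end
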